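(* Let $T>0$, $0<\alpha<1$ and $0<\eta\le\alpha$. A continuous path $Y:(0,T]\to\mathbb{R}$ belongs to $\mathcal{C}^{\alpha,\eta}((0,T])$ if and only if the re-parametrisation $t\mapsto Y(t^{\alpha/\eta})$, defined for $t\in(0,T^{\eta/\alpha}]$, belongs to $\mathcal{C}^\alpha([0,T^{\eta/\alpha}])$, in the sense that it extends to an $\alpha$-Hölder function on $[0,T^{\eta/\alpha}]$.
   Context: For $0<\alpha<1$ and $\eta\le\alpha$, $\mathcal{C}^{\alpha,\eta}((0,T])$ is the set of continuous $Y:(0,T]\to\mathbb{R}$ with $$\sup_{0<s<t\le T}\frac{|Y_t-Y_s|}{s^{\eta-\alpha}|t-s|^\alpha}<\infty.$$ *)

theory Defs
  imports "HOL-Analysis.Analysis"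
begin

text \<open>
  Paths on \<open>(0,T]\<close> are represented by total functions on the reals, of which only the
  values on \<open>{0<..T}\<close> are used. In particular nothing is assumed about the value at \<open>0\<close>.
  Finiteness of the supremum of the weighted difference quotients is expressed by \<open>bdd_above\<close>,
  since \<open>Sup\<close> on the reals is unspecified for unbounded sets.
\<close>

definition weighted_holder_space :: "real \<Rightarrow> real \<Rightarrow> real \<Rightarrow> (real \<Rightarrow> real) set" where
  "weighted_holder_space \<alpha> \<eta> T =
    {Y. continuous_on {0<..T} Y \<and>
        bdd_above {\<bar>Y t - Y s\<bar> / (s powr (\<eta> - \<alpha>) * \<bar>t - s\<bar> powr \<alpha>) | s t. 0 < s \<and> s < t \<and> t \<le> T}}"

definition holder_on :: "real \<Rightarrow> 'a::metric_space set \<Rightarrow> ('a \<Rightarrow> 'b::metric_space) \<Rightarrow> bool" where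
  "holder_on \<alpha> D f \<longleftrightarrow> (\<exists>C\<ge>0. \<forall>x\<in>D. \<forall>y\<in>D. dist (f x) (f y) \<le> C * dist x y powr \<alpha>)"

end

theory Submission
  imports Defs
begin

text \<open>
  Put \<open>p = \<alpha> / \<eta> \<ge> 1\<close>, \<open>q = 1 / p\<close> and \<open>X u = Y (u powr p)\<close>. The weight is the distortion of length
  under the change of variables: the derivative of \<open>s powr q\<close> is \<open>q * s powr (q - 1)\<close>, and
  \<open>s powr (q - 1)\<close> to the power \<open>\<alpha>\<close> is \<open>s powr (\<eta> - \<alpha>)\<close>. So an increment of \<open>Y\<close> is compared, on
  either side of the equivalence, with the power \<open>\<alpha>\<close> of essentially the same length.

  If \<open>X\<close> is Hoelder, then \<open>t powr q - s powr q \<le> s powr (q - 1) * (t - s)\<close> for \<open>s < t\<close> by concavity,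
  and the weighted bound follows at once (\<open>weighted_increment_bound_if_holder\<close>).

  In the other direction \<open>u powr p - v powr p \<le> p * u powr (p - 1) * (u - v)\<close> for \<open>v < u\<close>, whereas
  the weight is taken at the smaller point \<open>v\<close>; so one loses the factor \<open>u / v\<close> to the power
  \<open>(p - 1) * \<alpha>\<close>, which is bounded only for comparable points, say \<open>u \<le> 2 * v\<close>
  (\<open>increment_bound_comparable_if_weighted\<close>). Points that are far apart are joined by repeated
  halving of the larger one: the increments along the chain sum to a geometric series dominated by
  \<open>u powr \<alpha>\<close>, and \<open>u \<le> 2 * (u - v)\<close> when \<open>2 * v < u\<close> (\<open>holder_on_if_comparable\<close>). This gives a
  Hoelder bound for \<open>X\<close> on the half-open interval, and such a function extends to the closure with
  the same constant (\<open>holder_on_extends_to_closure\<close>).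
\<close>

section \<open>Hoelder functions\<close>

text \<open>
  A Hoelder function is uniformly continuous, hence extends continuously to the closure; the Hoelder
  inequality is a closed condition on the pair of points and survives the limit.
\<close>

lemma holder_on_extends_to_closure:
  fixes f :: "'a::metric_space \<Rightarrow> 'b::complete_space"
  assumes "0 < \<alpha>" "holder_on \<alpha> D f"
  obtains g where "holder_on \<alpha> (closure D) g" "\<And>x. x \<in> D \<Longrightarrow> g x = f x"
proof -
  obtain C where C: "C \<ge> 0"
    and hold: "\<And>x y. x \<in> D \<Longrightarrow> y \<in> D \<Longrightarrow> dist (f x) (f y) \<le> C * dist x y powr \<alpha>"
    using assms(2) by (auto simp: holder_on_def)
  have "uniformly_continuous_on D f"
    unfolding uniformly_continuous_on_def
  proof (intro allI impI)
    fix e :: real assume e: "e > 0"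
    \<comment> \<open>\<open>C + 1\<close> instead of \<open>C\<close>, which may vanish.\<close>
    define d where "d = (e / (C + 1)) powr (1 / \<alpha>)"
    have "dist (f y) (f x) < e" if "x \<in> D" "y \<in> D" "dist y x < d" for x y
    proof -
      have "dist y x powr \<alpha> < d powr \<alpha>"
        using that assms(1) by (intro powr_less_mono2) auto
      also have "d powr \<alpha> = e / (C + 1)"
        using assms(1) e C by (simp add: d_def powr_powr)
      finally have "(C + 1) * dist y x powr \<alpha> < e"
        using C by (simp add: field_simps)
      moreover have "dist (f y) (f x) \<le> (C + 1) * dist y x powr \<alpha>"
        using hold[OF that(2,1)] by (simp add: distrib_right add_increasing2)
      ultimately show ?thesis by linarith
    qed
    moreover have "d > 0" using e C by (simp add: d_def)
    ultimately show "\<exists>d>0. \<forall>x\<in>D. \<forall>y\<in>D. dist y x < d \<longrightarrow> dist (f y) (f x) < e" by blast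
  qed
  then obtain g where g: "uniformly_continuous_on (closure D) g"
    and gf: "\<And>x. x \<in> D \<Longrightarrow> f x = g x"
    using uniformly_continuous_on_extension_on_closure by metis
  have cont: "continuous_on (closure D) g"
    using g by (rule uniformly_continuous_imp_continuous)
  have "dist (g x) (g y) \<le> C * dist x y powr \<alpha>" if xy: "x \<in> closure D" "y \<in> closure D" for x y
  proof -
    obtain xs ys where xs: "\<And>n. xs n \<in> D" "xs \<longlonglongrightarrow> x" and ys: "\<And>n. ys n \<in> D" "ys \<longlonglongrightarrow> y"
      using xy unfolding closure_sequential by blast
    have "xs n \<in> closure D" "ys n \<in> closure D" for n
      using xs(1) ys(1) closure_subset by blast+
    then have gx: "(\<lambda>n. g (xs n)) \<longlonglongrightarrow> g x" and gy: "(\<lambda>n. g (ys n)) \<longlonglongrightarrow> g y"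
      using xs ys xy by (auto intro!: continuous_on_tendsto_compose[OF cont])
    have "(\<lambda>n. C * dist (xs n) (ys n) powr \<alpha>) \<longlonglongrightarrow> C * dist x y powr \<alpha>"
      using assms(1) xs ys by (intro tendsto_intros tendsto_powr') auto
    moreover have "(\<lambda>n. dist (g (xs n)) (g (ys n))) \<longlonglongrightarrow> dist (g x) (g y)"
      using gx gy by (rule tendsto_dist)
    ultimately show ?thesis
      using hold gf xs ys by (intro LIMSEQ_le) auto
  qed
  then have "holder_on \<alpha> (closure D) g" using C unfolding holder_on_def by blast
  then show thesis using that gf by simp
qed

text \<open>
  Chaining: a Hoelder bound between points of \<open>{0<..b}\<close> within a factor \<open>2\<close> of each other suffices.
  The constant \<open>K\<close> solves \<open>K = D + K / 2 powr \<alpha>\<close>: the bound by \<open>K * u powr \<alpha>\<close> then follows from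
  the same bound at \<open>u / 2\<close> and one step of the chain.
\<close>

lemma holder_on_if_comparable:
  fixes f :: "real \<Rightarrow> 'a::metric_space"
  assumes \<alpha>: "0 < \<alpha>" and D: "0 \<le> D"
    and near: "\<And>u v. 0 < v \<Longrightarrow> v < u \<Longrightarrow> u \<le> b \<Longrightarrow> u \<le> 2 * v \<Longrightarrow>
      dist (f u) (f v) \<le> D * (u - v) powr \<alpha>"
  shows "holder_on \<alpha> {0<..b} f"
proof -
  define r :: real where "r = 2 powr - \<alpha>"
  have r: "0 < r" "r < 1"
    using \<alpha> powr_less_mono[of "-\<alpha>" 0 "2::real"] by (auto simp: r_def)
  define K where "K = D / (1 - r)"
  have K: "D + K * r = K" "0 \<le> K" and DK: "D \<le> K"
    using r D by (auto simp: K_def field_simps)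
  have chain: "dist (f u) (f v) \<le> K * u powr \<alpha>"
    if "0 < v" "v < u" "u \<le> b" "u \<le> 2 ^ n * v" for n u v
    using that
  proof (induction n arbitrary: u)
    case 0
    then show ?case by simp
  next
    case (Suc n)
    show ?case
    proof (cases "u \<le> 2 * v")
      case True
      have "dist (f u) (f v) \<le> D * (u - v) powr \<alpha>"
        using Suc.prems True by (intro near) auto
      also have "\<dots> \<le> K * u powr \<alpha>"
        using Suc.prems \<alpha> K DK by (intro mult_mono powr_mono2) auto
      finally show ?thesis .
    next
      case False
      have half: "(u / 2) powr \<alpha> = r * u powr \<alpha>"
        using Suc.prems by (simp add: r_def powr_divide powr_minus field_simps)
      have "dist (f u) (f (u / 2)) \<le> D * (u - u / 2) powr \<alpha>"
        using Suc.prems by (intro near) auto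
      also have "\<dots> \<le> D * u powr \<alpha>"
        using Suc.prems \<alpha> D by (intro mult_left_mono powr_mono2) auto
      finally have "dist (f u) (f (u / 2)) \<le> D * u powr \<alpha>" .
      moreover have "dist (f (u / 2)) (f v) \<le> K * (u / 2) powr \<alpha>"
        using Suc.prems False by (intro Suc.IH) auto
      ultimately have "dist (f u) (f v) \<le> D * u powr \<alpha> + K * (u / 2) powr \<alpha>"
        using dist_triangle[of "f u" "f v" "f (u / 2)"] by linarith
      also have "\<dots> = (D + K * r) * u powr \<alpha>"
        by (simp add: half algebra_simps)
      finally show ?thesis by (simp add: K)
    qed
  qed
  define C where "C = K * 2 powr \<alpha>"
  have "1 \<le> (2::real) powr \<alpha>"
    using \<alpha> by (intro ge_one_powr_ge_zero) auto
  then have KC: "K \<le> C"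
    using K mult_left_mono[of 1 "2 powr \<alpha>" K] by (simp add: C_def)
  have bound: "dist (f u) (f v) \<le> C * (u - v) powr \<alpha>" if uv: "0 < v" "v < u" "u \<le> b" for u v
  proof (cases "u \<le> 2 * v")
    case True
    have "dist (f u) (f v) \<le> D * (u - v) powr \<alpha>"
      using uv True by (intro near) auto
    also have "\<dots> \<le> C * (u - v) powr \<alpha>"
      using DK KC by (intro mult_right_mono) auto
    finally show ?thesis .
  next
    case False
    obtain n where "u / v < 2 ^ n"
      using real_arch_pow[of 2 "u / v"] by auto
    then have "dist (f u) (f v) \<le> K * u powr \<alpha>"
      using uv by (intro chain[of v u n]) (auto simp: field_simps)
    also have "\<dots> \<le> K * (2 * (u - v)) powr \<alpha>"
      using uv False \<alpha> K by (intro mult_left_mono powr_mono2) auto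
    also have "\<dots> = C * (u - v) powr \<alpha>"
      using powr_mult[of 2 "u - v" \<alpha>] uv by (simp add: C_def)
    finally show ?thesis .
  qed
  have "dist (f x) (f y) \<le> C * dist x y powr \<alpha>" if "x \<in> {0<..b}" "y \<in> {0<..b}" for x y
    using that bound[of x y] bound[of y x]
    by (cases x y rule: linorder_cases) (auto simp: dist_commute dist_real_def)
  moreover have "0 \<le> C" using K KC by linarith
  ultimately show ?thesis by (auto simp: holder_on_def)
qed

section \<open>Weighted increments under a power change of variables\<close>

lemma powr_diff_mean_value:
  fixes v u a :: real
  assumes "0 < v" "v < u"
  obtains z where "v < z" "z < u" "u powr a - v powr a = a * z powr (a - 1) * (u - v)"
proof -
  have "\<exists>z>v. z < u \<and> u powr a - v powr a = (u - v) * (a * z powr (a - 1))"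
    using assms by (intro MVT2) (auto intro!: has_real_derivative_powr)
  then show thesis using that by (auto simp: mult_ac)
qed

lemma weighted_holder_space_iff:
  "Y \<in> weighted_holder_space \<alpha> \<eta> T \<longleftrightarrow> continuous_on {0<..T} Y \<and>
    (\<exists>M\<ge>0. \<forall>s t. 0 < s \<longrightarrow> s < t \<longrightarrow> t \<le> T \<longrightarrow>
      \<bar>Y t - Y s\<bar> \<le> M * (s powr (\<eta> - \<alpha>) * (t - s) powr \<alpha>))"
proof -
  have quot: "\<bar>Y t - Y s\<bar> / (s powr (\<eta> - \<alpha>) * \<bar>t - s\<bar> powr \<alpha>) \<le> M \<longleftrightarrow>
      \<bar>Y t - Y s\<bar> \<le> M * (s powr (\<eta> - \<alpha>) * (t - s) powr \<alpha>)" if "0 < s" "s < t" for s t M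
    using that by (simp add: pos_divide_le_eq)
  have "bdd_above {\<bar>Y t - Y s\<bar> / (s powr (\<eta> - \<alpha>) * \<bar>t - s\<bar> powr \<alpha>) | s t. 0 < s \<and> s < t \<and> t \<le> T}
    \<longleftrightarrow> (\<exists>M. \<forall>s t. 0 < s \<longrightarrow> s < t \<longrightarrow> t \<le> T \<longrightarrow>
      \<bar>Y t - Y s\<bar> / (s powr (\<eta> - \<alpha>) * \<bar>t - s\<bar> powr \<alpha>) \<le> M)"
    unfolding bdd_above_def by blast
  also have "\<dots> \<longleftrightarrow> (\<exists>M\<ge>0. \<forall>s t. 0 < s \<longrightarrow> s < t \<longrightarrow> t \<le> T \<longrightarrow>
      \<bar>Y t - Y s\<bar> / (s powr (\<eta> - \<alpha>) * \<bar>t - s\<bar> powr \<alpha>) \<le> M)"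
  proof
    assume "\<exists>M. \<forall>s t. 0 < s \<longrightarrow> s < t \<longrightarrow> t \<le> T \<longrightarrow>
      \<bar>Y t - Y s\<bar> / (s powr (\<eta> - \<alpha>) * \<bar>t - s\<bar> powr \<alpha>) \<le> M"
    then obtain M where "\<And>s t. 0 < s \<Longrightarrow> s < t \<Longrightarrow> t \<le> T \<Longrightarrow>
      \<bar>Y t - Y s\<bar> / (s powr (\<eta> - \<alpha>) * \<bar>t - s\<bar> powr \<alpha>) \<le> M" by auto
    then show "\<exists>M\<ge>0. \<forall>s t. 0 < s \<longrightarrow> s < t \<longrightarrow> t \<le> T \<longrightarrow>
      \<bar>Y t - Y s\<bar> / (s powr (\<eta> - \<alpha>) * \<bar>t - s\<bar> powr \<alpha>) \<le> M"
      by (intro exI[of _ "max 0 M"]) (simp add: le_max_iff_disj)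
  qed auto
  also have "\<dots> \<longleftrightarrow> (\<exists>M\<ge>0. \<forall>s t. 0 < s \<longrightarrow> s < t \<longrightarrow> t \<le> T \<longrightarrow>
      \<bar>Y t - Y s\<bar> \<le> M * (s powr (\<eta> - \<alpha>) * (t - s) powr \<alpha>))"
    by (intro ex_cong1 conj_cong all_cong1 imp_cong refl quot)
  finally show ?thesis
    by (simp only: weighted_holder_space_def mem_Collect_eq)
qed

text \<open>
  With \<open>s = v powr p\<close> the weight is \<open>v powr (1 - p)\<close> to the power \<open>\<alpha>\<close>. It cancels the factor
  \<open>z powr (p - 1)\<close> from the derivative of the \<open>p\<close>-th power at a point \<open>z\<close> between \<open>v\<close> and \<open>u\<close>, up to
  \<open>2 powr (p - 1)\<close> because \<open>z \<le> 2 * v\<close>.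
\<close>

lemma increment_bound_comparable_if_weighted:
  fixes Y :: "real \<Rightarrow> real"
  assumes \<eta>: "0 < \<eta>" "\<eta> \<le> \<alpha>" and T: "0 < T" and M: "0 \<le> M"
    and Y: "\<And>s t. 0 < s \<Longrightarrow> s < t \<Longrightarrow> t \<le> T \<Longrightarrow>
      \<bar>Y t - Y s\<bar> \<le> M * (s powr (\<eta> - \<alpha>) * (t - s) powr \<alpha>)"
    and uv: "0 < v" "v < u" "u \<le> T powr (\<eta> / \<alpha>)" "u \<le> 2 * v"
  defines "p \<equiv> \<alpha> / \<eta>"
  shows "\<bar>Y (u powr p) - Y (v powr p)\<bar> \<le> M * (p * 2 powr (p - 1)) powr \<alpha> * (u - v) powr \<alpha>"
proof -
  have p: "1 \<le> p" using \<eta> by (simp add: p_def)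
  have T_eq: "(T powr (\<eta> / \<alpha>)) powr p = T"
    using \<eta> T by (simp add: p_def powr_powr)
  have "u powr p \<le> T"
    using powr_mono2[of p u "T powr (\<eta> / \<alpha>)"] p uv by (simp add: T_eq)
  moreover have vu: "v powr p < u powr p"
    using p uv by (intro powr_less_mono2) auto
  ultimately have "\<bar>Y (u powr p) - Y (v powr p)\<bar>
      \<le> M * ((v powr p) powr (\<eta> - \<alpha>) * (u powr p - v powr p) powr \<alpha>)"
    using uv by (intro Y) auto
  also have "(v powr p) powr (\<eta> - \<alpha>) * (u powr p - v powr p) powr \<alpha>
      = (v powr (1 - p) * (u powr p - v powr p)) powr \<alpha>"
  proof -
    have "p * (\<eta> - \<alpha>) = (1 - p) * \<alpha>" using \<eta> by (simp add: p_def field_simps)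
    then show ?thesis using vu by (simp add: powr_powr powr_mult)
  qed
  also have "\<dots> \<le> (p * 2 powr (p - 1) * (u - v)) powr \<alpha>"
  proof (rule powr_mono2)
    obtain z where z: "v < z" "z < u" "u powr p - v powr p = p * z powr (p - 1) * (u - v)"
      using powr_diff_mean_value[OF uv(1,2)] .
    have "z powr (p - 1) \<le> (2 * v) powr (p - 1)"
      using z uv p by (intro powr_mono2) auto
    then have "v powr (1 - p) * z powr (p - 1) \<le> v powr (1 - p) * (2 powr (p - 1) * v powr (p - 1))"
      using uv by (simp add: powr_mult)
    also have "\<dots> = 2 powr (p - 1)"
      using uv by (simp add: powr_diff field_simps)
    finally have "p * (u - v) * (v powr (1 - p) * z powr (p - 1)) \<le> p * (u - v) * 2 powr (p - 1)"
      using p uv by (intro mult_left_mono) auto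
    then show "v powr (1 - p) * (u powr p - v powr p) \<le> p * 2 powr (p - 1) * (u - v)"
      by (simp add: z(3) mult_ac)
  qed (use \<eta> vu in auto)
  also have "\<dots> = (p * 2 powr (p - 1)) powr \<alpha> * (u - v) powr \<alpha>"
    using p uv by (simp add: powr_mult)
  finally show ?thesis using M by (simp add: mult_left_mono mult.assoc)
qed

text \<open>
  The derivative of \<open>x powr q\<close>, where \<open>q = \<eta> / \<alpha> \<le> 1\<close>, decreases, so it is largest at the left end
  point \<open>s\<close>, where the weight is taken. This is why the bound holds for all pairs of points, and the
  constant stays the same as \<open>q \<le> 1\<close>.
\<close>

lemma weighted_increment_bound_if_holder:
  fixes Y :: "real \<Rightarrow> real"
  assumes \<eta>: "0 < \<eta>" "\<eta> \<le> \<alpha>" and C: "0 \<le> C"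
    and X: "\<And>u v. 0 < v \<Longrightarrow> v < u \<Longrightarrow> u \<le> T powr (\<eta> / \<alpha>) \<Longrightarrow>
      \<bar>Y (u powr (\<alpha> / \<eta>)) - Y (v powr (\<alpha> / \<eta>))\<bar> \<le> C * (u - v) powr \<alpha>"
    and st: "0 < s" "s < t" "t \<le> T"
  shows "\<bar>Y t - Y s\<bar> \<le> C * (s powr (\<eta> - \<alpha>) * (t - s) powr \<alpha>)"
proof -
  define q where "q = \<eta> / \<alpha>"
  have q: "0 < q" "q \<le> 1" using \<eta> by (auto simp: q_def)
  have inv: "(x powr q) powr (\<alpha> / \<eta>) = x" if "0 < x" for x
    using that \<eta> by (simp add: q_def powr_powr)
  have less: "s powr q < t powr q"
    using st q by (intro powr_less_mono2) auto
  have "\<bar>Y ((t powr q) powr (\<alpha> / \<eta>)) - Y ((s powr q) powr (\<alpha> / \<eta>))\<bar> \<le> C * (t powr q - s powr q) powr \<alpha>"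
    using st q less by (intro X) (auto simp flip: q_def intro: powr_mono2)
  then have "\<bar>Y t - Y s\<bar> \<le> C * (t powr q - s powr q) powr \<alpha>"
    using st by (simp add: inv)
  also have "\<dots> \<le> C * (s powr (q - 1) * (t - s)) powr \<alpha>"
  proof (intro mult_left_mono powr_mono2)
    obtain z where z: "s < z" "z < t" "t powr q - s powr q = q * z powr (q - 1) * (t - s)"
      using powr_diff_mean_value[OF st(1,2)] .
    have "z powr (q - 1) \<le> s powr (q - 1)"
      using z st q by (intro powr_mono2') auto
    then have "q * z powr (q - 1) \<le> 1 * s powr (q - 1)"
      using q by (intro mult_mono) auto
    then show "t powr q - s powr q \<le> s powr (q - 1) * (t - s)"
      using st by (simp add: z(3))
  qed (use \<eta> C less in auto)
  also have "(s powr (q - 1) * (t - s)) powr \<alpha> = s powr (\<eta> - \<alpha>) * (t - s) powr \<alpha>"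
  proof -
    have "(q - 1) * \<alpha> = \<eta> - \<alpha>" using \<eta> by (simp add: q_def field_simps)
    then show ?thesis using st by (simp add: powr_mult powr_powr)
  qed
  finally show ?thesis .
qed

section \<open>Weighted spaces as reparametrised Hoelder spaces\<close>

theorem proposition2p4:
  fixes T \<alpha> \<eta> :: real and Y :: "real \<Rightarrow> real"
  assumes "0 < T" and "0 < \<alpha>" and "\<alpha> < 1" and "0 < \<eta>" and "\<eta> \<le> \<alpha>"
    and "continuous_on {0<..T} Y"
  shows "Y \<in> weighted_holder_space \<alpha> \<eta> T \<longleftrightarrow>
    (\<exists>Z :: real \<Rightarrow> real. holder_on \<alpha> {0..T powr (\<eta> / \<alpha>)} Z \<and>
       (\<forall>t\<in>{0<..T powr (\<eta> / \<alpha>)}. Z t = Y (t powr (\<alpha> / \<eta>))))"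
proof
  assume "Y \<in> weighted_holder_space \<alpha> \<eta> T"
  then obtain M where M: "M \<ge> 0" and Y: "\<And>s t. 0 < s \<Longrightarrow> s < t \<Longrightarrow> t \<le> T \<Longrightarrow>
      \<bar>Y t - Y s\<bar> \<le> M * (s powr (\<eta> - \<alpha>) * (t - s) powr \<alpha>)"
    unfolding weighted_holder_space_iff by blast
  have X: "holder_on \<alpha> {0<..T powr (\<eta> / \<alpha>)} (\<lambda>u. Y (u powr (\<alpha> / \<eta>)))"
    using increment_bound_comparable_if_weighted[OF assms(4,5,1) M Y] assms M
    by (intro holder_on_if_comparable
          [where D = "M * (\<alpha> / \<eta> * 2 powr (\<alpha> / \<eta> - 1)) powr \<alpha>"]) (auto simp: dist_real_def)
  obtain Z where "holder_on \<alpha> (closure {0<..T powr (\<eta> / \<alpha>)}) Z"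
    and "\<And>t. t \<in> {0<..T powr (\<eta> / \<alpha>)} \<Longrightarrow> Z t = Y (t powr (\<alpha> / \<eta>))"
    by (rule holder_on_extends_to_closure[OF \<open>0 < \<alpha>\<close> X]) blast
  moreover have "closure {0<..T powr (\<eta> / \<alpha>)} = {0..T powr (\<eta> / \<alpha>)}"
    using assms by simp
  ultimately show "\<exists>Z :: real \<Rightarrow> real. holder_on \<alpha> {0..T powr (\<eta> / \<alpha>)} Z \<and>
       (\<forall>t\<in>{0<..T powr (\<eta> / \<alpha>)}. Z t = Y (t powr (\<alpha> / \<eta>)))" by auto
next
  assume "\<exists>Z :: real \<Rightarrow> real. holder_on \<alpha> {0..T powr (\<eta> / \<alpha>)} Z \<and>
       (\<forall>t\<in>{0<..T powr (\<eta> / \<alpha>)}. Z t = Y (t powr (\<alpha> / \<eta>)))"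
  then obtain Z where "holder_on \<alpha> {0..T powr (\<eta> / \<alpha>)} Z"
    and ZY: "\<And>t. t \<in> {0<..T powr (\<eta> / \<alpha>)} \<Longrightarrow> Z t = Y (t powr (\<alpha> / \<eta>))"
    by blast
  then obtain C where C: "C \<ge> 0"
    and Z: "\<And>x y. x \<in> {0..T powr (\<eta> / \<alpha>)} \<Longrightarrow> y \<in> {0..T powr (\<eta> / \<alpha>)} \<Longrightarrow>
      dist (Z x) (Z y) \<le> C * dist x y powr \<alpha>"
    unfolding holder_on_def by blast
  have X: "\<bar>Y (u powr (\<alpha> / \<eta>)) - Y (v powr (\<alpha> / \<eta>))\<bar> \<le> C * (u - v) powr \<alpha>"
    if "0 < v" "v < u" "u \<le> T powr (\<eta> / \<alpha>)" for u v
    using Z[of u v] ZY[of u] ZY[of v] that by (simp add: dist_real_def)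
  have "\<bar>Y t - Y s\<bar> \<le> C * (s powr (\<eta> - \<alpha>) * (t - s) powr \<alpha>)"
    if "0 < s" "s < t" "t \<le> T" for s t
    using weighted_increment_bound_if_holder[OF assms(4,5) C X that] .
  then show "Y \<in> weighted_holder_space \<alpha> \<eta> T"
    unfolding weighted_holder_space_iff using assms(6) C by auto
qed

end
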